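(* Let $T$ be a finite or infinite tree of maximal valence $k<\infty$, and let $c$ be an integer with $2 \leq c \leq k$. Suppose $r$ is an integer satisfying $3 < k \leq 2^{r-1}$ if $c=2$, or $3<k\leq c^r(c-1)+2$ if $c>2$. Then there exists a $c$-coloring of the vertices of $T$ such that every automorphism of $T$ preserving the coloring fixes every vertex of $T$ whose distance to the nearest leaf of $T$ is at least $r$. Furthermore, the same conclusion holds with $r=0$ when $c=k$, and with $r=1$ when $c=k-1$.
   Context: A $c$-coloring is a map from the vertex set to $\{1,\dots,c\}$; an automorphism $\varphi$ preserves a coloring $\mathfrak{c}$ if $\mathfrak{c}(\varphi(x))=\mathfrak{c}(x)$ for all vertices $x$. A leaf is a vertex of valence $1$. The distance between vertices is the number of edges on a shortest path; if $T$ has no leaves, every vertex is regarded as being at distance at least $r$ from the nearest leaf (so then all vertices are to be fixed).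
   Formalization: The main part also assumes r ≥ 1; this removes only r = 0 with c = k−1 ≥ 3, where the claim fails: in the star with k leaves, two leaves share one of the k−1 colors and can be swapped. The case r = 0, c = k is kept. *)

theory Defs
  imports Main "HOL-Library.Extended_Nat"
begin

text \<open>
  A simple undirected graph is a vertex set \<open>V\<close>, finite or infinite, together with its
  symmetric, irreflexive adjacency relation \<open>E\<close>.
\<close>

definition simple_graph :: "'a set \<Rightarrow> ('a \<times> 'a) set \<Rightarrow> bool" where
  "simple_graph V E \<longleftrightarrow> E \<subseteq> V \<times> V \<and> sym E \<and> irrefl E"

definition is_path :: "('a \<times> 'a) set \<Rightarrow> 'a list \<Rightarrow> bool" where
  "is_path E p \<longleftrightarrow> p \<noteq> [] \<and> distinct p \<and> successively (\<lambda>x y. (x, y) \<in> E) p"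

definition path_between :: "('a \<times> 'a) set \<Rightarrow> 'a \<Rightarrow> 'a list \<Rightarrow> 'a \<Rightarrow> bool" where
  "path_between E x p y \<longleftrightarrow> is_path E p \<and> hd p = x \<and> last p = y"

text \<open>
  At least three vertices are required, since traversing one edge back and forth is not a cycle
  of an undirected graph.
\<close>

definition is_cycle :: "('a \<times> 'a) set \<Rightarrow> 'a list \<Rightarrow> bool" where
  "is_cycle E p \<longleftrightarrow> is_path E p \<and> 3 \<le> length p \<and> (last p, hd p) \<in> E"

definition is_tree :: "'a set \<Rightarrow> ('a \<times> 'a) set \<Rightarrow> bool" where
  "is_tree V E \<longleftrightarrow> simple_graph V E \<and> V \<noteq> {} \<and>
     (\<forall>x\<in>V. \<forall>y\<in>V. \<exists>p. path_between E x p y) \<and> (\<nexists>p. is_cycle E p)"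

definition valence :: "('a \<times> 'a) set \<Rightarrow> 'a \<Rightarrow> nat" where
  "valence E x = card (E `` {x})"

text \<open>
  Finiteness of the neighbourhoods is stated separately because \<open>card\<close> is 0 on infinite sets.
\<close>

definition max_valence :: "'a set \<Rightarrow> ('a \<times> 'a) set \<Rightarrow> nat \<Rightarrow> bool" where
  "max_valence V E k \<longleftrightarrow>
     (\<forall>x\<in>V. finite (E `` {x}) \<and> valence E x \<le> k) \<and> (\<exists>x\<in>V. valence E x = k)"

definition leaves :: "'a set \<Rightarrow> ('a \<times> 'a) set \<Rightarrow> 'a set" where
  "leaves V E = {x \<in> V. valence E x = 1}"

text \<open>A path with \<open>n\<close> edges is a list of \<open>n + 1\<close> vertices.\<close>

definition graph_dist :: "('a \<times> 'a) set \<Rightarrow> 'a \<Rightarrow> 'a \<Rightarrow> nat" where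
  "graph_dist E x y = (LEAST n. \<exists>p. path_between E x p y \<and> length p = n + 1)"

text \<open>If there are no leaves, this is the infimum of the empty set, hence \<open>\<infinity>\<close>.\<close>

definition leaf_dist :: "'a set \<Rightarrow> ('a \<times> 'a) set \<Rightarrow> 'a \<Rightarrow> enat" where
  "leaf_dist V E x = (INF l\<in>leaves V E. enat (graph_dist E x l))"

definition graph_automorphism :: "'a set \<Rightarrow> ('a \<times> 'a) set \<Rightarrow> ('a \<Rightarrow> 'a) \<Rightarrow> bool" where
  "graph_automorphism V E \<phi> \<longleftrightarrow> bij_betw \<phi> V V \<and>
     (\<forall>x\<in>V. \<forall>y\<in>V. (x, y) \<in> E \<longleftrightarrow> (\<phi> x, \<phi> y) \<in> E)"

definition is_coloring :: "'a set \<Rightarrow> nat \<Rightarrow> ('a \<Rightarrow> nat) \<Rightarrow> bool" where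
  "is_coloring V c col \<longleftrightarrow> (\<forall>x\<in>V. col x \<in> {1..c})"

definition preserves_coloring :: "'a set \<Rightarrow> ('a \<Rightarrow> nat) \<Rightarrow> ('a \<Rightarrow> 'a) \<Rightarrow> bool" where
  "preserves_coloring V col \<phi> \<longleftrightarrow> (\<forall>x\<in>V. col (\<phi> x) = col x)"

end

theory Submission
  imports Defs "HOL-Number_Theory.Cong"
begin

text \<open>
  In all cases \<open>k \<le> c ^ Suc r\<close>. Let \<open>M\<close> be the set of vertices to be fixed, and call a
  branch heavy if it meets \<open>M\<close>. If no vertex has two heavy branches, then \<open>M\<close> has at most two
  elements and coloring one of them differently suffices. Otherwise root the tree at a vertex \<open>v\<close>
  with two heavy branches. With colors taken in \<open>{0..<c}\<close>, attach to a branch with root \<open>u\<close> the sum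
  of \<open>c ^ i\<close> times the colors at depth \<open>i\<close>, for \<open>i \<le> r\<close>, modulo \<open>N = c ^ Suc r\<close>. The coloring is built
  downwards from \<open>v\<close> such that heavy siblings have distinct branch sums. The branch sum at \<open>u\<close>
  prescribes the sum over its children only modulo \<open>c ^ r\<close>. Since \<open>m < N\<close> distinct residues modulo
  \<open>N\<close> can have any sum, for each \<open>u \<noteq> v\<close> with a heavy child there is enough freedom left to make the
  sum over all branches at \<open>u\<close> different from the one at \<open>v\<close>. A color-preserving automorphism then
  fixes \<open>v\<close>, and by induction on the depth it fixes the root of every heavy branch.
\<close>

section \<open>Walks, distances and leaves\<close>

text \<open>Prepending a vertex either extends the path or, if the vertex already lies on it, allows
  everything before that occurrence to be cut off. Hence only an upper bound on the length
  survives.\<close>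

lemma relpow_imp_path_between:
  assumes "(x, y) \<in> R ^^ n"
  shows "\<exists>p. path_between R x p y \<and> length p \<le> n + 1"
  using assms
proof (induction n arbitrary: x)
  case 0
  then show ?case
    by (intro exI[of _ "[x]"]) (auto simp: path_between_def is_path_def)
next
  case (Suc n)
  then obtain z where z: "(x, z) \<in> R" "(z, y) \<in> R ^^ n"
    by (meson relpow_Suc_D2)
  from Suc.IH[OF z(2)] obtain p where p: "path_between R z p y" "length p \<le> n + 1"
    by blast
  show ?case
  proof (cases "x \<in> set p")
    case False
    then show ?thesis
      using p z(1)
      by (intro exI[of _ "x # p"])
         (auto simp: path_between_def is_path_def successively_Cons)
  next
    case True
    then obtain a b where ab: "p = a @ x # b"
      by (meson split_list)
    then show ?thesis
      using p
      by (intro exI[of _ "x # b"])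
         (auto simp: path_between_def is_path_def successively_append_iff)
  qed
qed

lemma path_between_imp_relpow:
  assumes "path_between R x p y"
  shows "(x, y) \<in> R ^^ (length p - 1)"
  using assms
proof (induction p arbitrary: x)
  case Nil
  then show ?case by (simp add: path_between_def is_path_def)
next
  case (Cons a p)
  show ?case
  proof (cases "p = []")
    case True
    then show ?thesis using Cons.prems by (auto simp: path_between_def)
  next
    case False
    then have "path_between R (hd p) p y" "(x, hd p) \<in> R"
      using Cons.prems by (auto simp: path_between_def is_path_def successively_Cons)
    with Cons.IH have "(hd p, y) \<in> R ^^ (length p - 1)" by blast
    with \<open>(x, hd p) \<in> R\<close> have "(x, y) \<in> R ^^ Suc (length p - 1)"
      by (rule relpow_Suc_I2)
    with False show ?thesis by (cases p) auto
  qed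
qed

text \<open>Shortened to a path and closed up through \<open>x\<close>, the walk becomes a cycle;
  \<open>y \<noteq> z\<close> gives it at least three vertices.\<close>

lemma tree_no_detour:
  assumes "is_tree V E" "(y, x) \<in> E" "(z, x) \<in> E" "y \<noteq> z"
    and walk: "(y, z) \<in> (E \<inter> (- {x}) \<times> (- {x}))\<^sup>*"
  shows False
proof -
  let ?R = "E \<inter> (- {x}) \<times> (- {x})"
  have E: "sym E" "irrefl E" and nocyc: "\<nexists>p. is_cycle E p"
    using assms(1) by (auto simp: is_tree_def simple_graph_def)
  obtain p where p: "path_between ?R y p z"
    using walk relpow_imp_path_between[where R = ?R] unfolding rtrancl_power by blast
  \<comment> \<open>Every edge of \<open>?R\<close> avoids \<open>x\<close> at both ends, so only a
    one-vertex path could contain \<open>x\<close>; the condition on \<open>hd q\<close> excludes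
    that.\<close>
  have avoid: "x \<notin> set q" if "successively (\<lambda>a b. (a, b) \<in> ?R) q" "q \<noteq> []" "hd q \<noteq> x" for q
    using that
  proof (induction q)
    case (Cons b q)
    then show ?case by (cases "q = []") (auto simp: successively_Cons)
  qed simp
  have "y \<noteq> x" using assms(2) E(2) by (auto simp: irrefl_def)
  then have x: "x \<notin> set p"
    using avoid[of p] p by (auto simp: path_between_def is_path_def)
  have succ: "successively (\<lambda>a b. (a, b) \<in> E) p"
    using p by (auto simp: path_between_def is_path_def elim: successively_mono)
  have "2 \<le> length p"
    using p assms(4) by (cases p rule: list.exhaust; cases "tl p")
      (auto simp: path_between_def is_path_def)
  moreover have "(x, y) \<in> E" using assms(2) E(1) by (meson symD)
  ultimately have "is_cycle E (x # p)"
    using p x succ assms(3)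
    by (auto simp: is_cycle_def is_path_def path_between_def successively_Cons)
  with nocyc show False by blast
qed

text \<open>Distance at least \<open>n\<close> from all leaves, phrased with walks instead of
  shortest paths, which suits inductions along edges. It holds vacuously in a tree without
  leaves.\<close>

definition leaf_free :: "'a set \<Rightarrow> ('a \<times> 'a) set \<Rightarrow> nat \<Rightarrow> 'a \<Rightarrow> bool" where
  "leaf_free V E n x \<longleftrightarrow> (\<forall>j<n. \<forall>l\<in>leaves V E. (x, l) \<notin> E ^^ j)"

lemma leaf_free_mono: "leaf_free V E n x \<Longrightarrow> m \<le> n \<Longrightarrow> leaf_free V E m x"
  by (auto simp: leaf_free_def)

lemma leaf_free_Suc_neighbour:
  assumes "leaf_free V E (Suc n) x" "(x, y) \<in> E"
  shows "leaf_free V E n y"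
  unfolding leaf_free_def
proof (intro allI impI ballI notI)
  fix j l assume j: "j < n" "l \<in> leaves V E" "(y, l) \<in> E ^^ j"
  from assms(2) j(3) have "(x, l) \<in> E ^^ Suc j" by (rule relpow_Suc_I2)
  with assms(1) j show False unfolding leaf_free_def by (meson Suc_mono)
qed

lemma leaf_free_Suc_not_leaf: "leaf_free V E (Suc n) x \<Longrightarrow> x \<notin> leaves V E"
  unfolding leaf_free_def by (metis relpow_0_I zero_less_Suc)

text \<open>Walks shorten to paths, so the graph distance is also the least length of a
  walk.\<close>

lemma le_leaf_dist_iff_leaf_free:
  assumes "is_tree V E" "x \<in> V"
  shows "enat r \<le> leaf_dist V E x \<longleftrightarrow> leaf_free V E r x"
proof -
  have conn: "\<exists>p. path_between E x p l" if "l \<in> V" for l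
    using assms that by (auto simp: is_tree_def)
  have dist: "r \<le> graph_dist E x l \<longleftrightarrow> (\<forall>j<r. (x, l) \<notin> E ^^ j)" if "l \<in> V" for l
  proof -
    let ?P = "\<lambda>n. \<exists>p. path_between E x p l \<and> length p = n + 1"
    have len: "length p = (length p - 1) + 1" if "path_between E x p l" for p
      using that by (cases p) (auto simp: path_between_def is_path_def)
    obtain p where p: "path_between E x p l" using conn \<open>l \<in> V\<close> by blast
    then have "?P (length p - 1)" using len[OF p] by blast
    then have "?P (graph_dist E x l)" unfolding graph_dist_def by (rule LeastI)
    then have walk: "(x, l) \<in> E ^^ graph_dist E x l"
      using path_between_imp_relpow by fastforce
    have "graph_dist E x l \<le> j" if j: "(x, l) \<in> E ^^ j" for j
    proof -
      from relpow_imp_path_between[OF j] obtain q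
        where q: "path_between E x q l" "length q \<le> j + 1" by blast
      have "?P (length q - 1)" using len[OF q(1)] q(1) by blast
      then have "graph_dist E x l \<le> length q - 1" unfolding graph_dist_def by (rule Least_le)
      with q(2) show ?thesis by simp
    qed
    with walk show ?thesis by (meson le_less_trans not_le order_trans)
  qed
  have "leaves V E \<subseteq> V" by (auto simp: leaves_def)
  with dist show ?thesis
    by (auto simp: leaf_dist_def le_INF_iff leaf_free_def subset_iff)
qed

section \<open>Automorphisms\<close>

lemma graph_automorphism_neighbours:
  assumes "simple_graph V E" "graph_automorphism V E \<phi>" "x \<in> V"
  shows "E `` {\<phi> x} = \<phi> ` (E `` {x})"
proof -
  have EV: "E \<subseteq> V \<times> V" using assms(1) by (simp add: simple_graph_def)
  have bij: "\<phi> ` V = V" using assms(2) by (auto simp: graph_automorphism_def bij_betw_def)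
  have iff: "(a, b) \<in> E \<longleftrightarrow> (\<phi> a, \<phi> b) \<in> E" if "a \<in> V" "b \<in> V" for a b
    using assms(2) that by (auto simp: graph_automorphism_def)
  show ?thesis
  proof (intro equalityI subsetI)
    fix y assume "y \<in> E `` {\<phi> x}"
    then have "(\<phi> x, y) \<in> E" by simp
    moreover from this obtain z where "z \<in> V" "y = \<phi> z" using EV bij by blast
    ultimately show "y \<in> \<phi> ` (E `` {x})" using iff assms(3) by auto
  next
    fix y assume "y \<in> \<phi> ` (E `` {x})"
    then show "y \<in> E `` {\<phi> x}" using iff assms(3) EV by auto
  qed
qed

lemma graph_automorphism_inj: "graph_automorphism V E \<phi> \<Longrightarrow> inj_on \<phi> V"
  by (auto simp: graph_automorphism_def bij_betw_def)

lemma graph_automorphism_in: "graph_automorphism V E \<phi> \<Longrightarrow> x \<in> V \<Longrightarrow> \<phi> x \<in> V"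
  by (auto simp: graph_automorphism_def bij_betw_def)

text \<open>Walks from \<open>\<phi> x\<close> are pulled back edge by edge, so that the inverse
  automorphism never has to be handled.\<close>

lemma graph_automorphism_relpow:
  assumes "simple_graph V E" "graph_automorphism V E \<phi>" "x \<in> V" "(\<phi> x, y) \<in> E ^^ n"
  shows "\<exists>z\<in>V. y = \<phi> z \<and> (x, z) \<in> E ^^ n"
  using assms(4)
proof (induction n arbitrary: y)
  case 0
  then show ?case using assms(3) by auto
next
  case (Suc n)
  then obtain w where w: "(\<phi> x, w) \<in> E ^^ n" "(w, y) \<in> E" by auto
  with Suc.IH obtain z where z: "z \<in> V" "w = \<phi> z" "(x, z) \<in> E ^^ n" by blast
  with w(2) have "y \<in> \<phi> ` (E `` {z})"
    using graph_automorphism_neighbours[OF assms(1,2)] by blast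
  then obtain z' where "(z, z') \<in> E" "y = \<phi> z'" by blast
  moreover have "E \<subseteq> V \<times> V" using assms(1) by (simp add: simple_graph_def)
  ultimately show ?case using z(3) by auto
qed

text \<open>A leaf near \<open>\<phi> x\<close> pulls back to a leaf equally near \<open>x\<close>,
  because valences are preserved. This makes the set of vertices to be fixed invariant.\<close>

lemma graph_automorphism_leaf_free:
  assumes "simple_graph V E" "graph_automorphism V E \<phi>" "x \<in> V" "leaf_free V E n x"
  shows "leaf_free V E n (\<phi> x)"
  unfolding leaf_free_def
proof (intro allI impI ballI notI)
  fix j l assume j: "j < n" "l \<in> leaves V E" "(\<phi> x, l) \<in> E ^^ j"
  from graph_automorphism_relpow[OF assms(1,2,3) j(3)]
  obtain z where z: "z \<in> V" "l = \<phi> z" "(x, z) \<in> E ^^ j" by blast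
  have "E `` {z} \<subseteq> V" using assms(1) by (auto simp: simple_graph_def)
  then have "card (E `` {\<phi> z}) = card (E `` {z})"
    using graph_automorphism_neighbours[OF assms(1,2) z(1)] graph_automorphism_inj[OF assms(2)]
    by (metis card_image inj_on_subset)
  then have "z \<in> leaves V E" using j(2) z by (simp add: leaves_def valence_def)
  with z(3) assms(4) j(1) show False by (auto simp: leaf_free_def)
qed

text \<open>\<open>heavy E M p u\<close>: starting with the edge from \<open>p\<close> to \<open>u\<close>, a walk that never turns back
  reaches \<open>M\<close>. In a tree, it says that the branch at \<open>u\<close> away from \<open>p\<close> meets \<open>M\<close>.\<close>

inductive heavy :: "('a \<times> 'a) set \<Rightarrow> 'a set \<Rightarrow> 'a \<Rightarrow> 'a \<Rightarrow> bool" for E M where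
  here: "u \<in> M \<Longrightarrow> heavy E M p u"
| step: "(u, x) \<in> E \<Longrightarrow> x \<noteq> p \<Longrightarrow> heavy E M u x \<Longrightarrow> heavy E M p u"

text \<open>Injectivity of \<open>\<phi>\<close> keeps a walk that never turns back from turning
  back in the image.\<close>

lemma graph_automorphism_heavy:
  assumes "heavy E M p u" "simple_graph V E" "graph_automorphism V E \<phi>" "\<phi> ` M \<subseteq> M"
    and "p \<in> V" "u \<in> V"
  shows "heavy E M (\<phi> p) (\<phi> u)"
  using assms(1,5,6)
proof (induction rule: heavy.induct)
  case (here u p)
  then show ?case using assms(4) by (blast intro: heavy.here)
next
  case (step u x p)
  have x: "x \<in> V" using step.hyps(1) assms(2) by (auto simp: simple_graph_def)
  then have "(\<phi> u, \<phi> x) \<in> E"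
    using step assms(3) by (auto simp: graph_automorphism_def)
  moreover have "\<phi> x \<noteq> \<phi> p"
    using graph_automorphism_inj[OF assms(3)] x step by (auto dest: inj_onD)
  ultimately show ?case using step x by (blast intro: heavy.step)
qed

text \<open>Horner form of the sum of c^i times the total color at depth i, for i up to the given
  bound, in the branch at \<open>u\<close> away from \<open>p\<close>. Reduction modulo a power of
  \<open>c\<close> is left to the congruences.\<close>

primrec branch_sum :: "('a \<times> 'a) set \<Rightarrow> nat \<Rightarrow> ('a \<Rightarrow> nat) \<Rightarrow> nat \<Rightarrow> 'a \<Rightarrow> 'a \<Rightarrow> nat" where
  "branch_sum E c col 0 p u = col u"
| "branch_sum E c col (Suc n) p u =
     col u + c * (\<Sum>x\<in>E `` {u} - {p}. branch_sum E c col n u x)"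

lemma graph_automorphism_branch_sum:
  assumes "simple_graph V E" "graph_automorphism V E \<phi>" "preserves_coloring V col \<phi>"
    and "p \<in> V" "u \<in> V"
  shows "branch_sum E c col n (\<phi> p) (\<phi> u) = branch_sum E c col n p u"
  using assms(4,5)
proof (induction n arbitrary: p u)
  case 0
  then show ?case using assms(3) by (simp add: preserves_coloring_def)
next
  case (Suc n)
  have sub: "E `` {u} - {p} \<subseteq> V" using assms(1) by (auto simp: simple_graph_def)
  have inj: "inj_on \<phi> V" by (rule graph_automorphism_inj[OF assms(2)])
  have sub': "E `` {u} \<subseteq> V" using assms(1) by (auto simp: simple_graph_def)
  have "\<phi> ` (E `` {u} - {p}) = \<phi> ` (E `` {u}) - \<phi> ` {p}"
    using inj sub' Suc.prems(1) by (intro inj_on_image_set_diff[of \<phi> V]) auto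
  then have "E `` {\<phi> u} - {\<phi> p} = \<phi> ` (E `` {u} - {p})"
    using graph_automorphism_neighbours[OF assms(1,2) Suc.prems(2)] by simp
  then have "(\<Sum>x\<in>E `` {\<phi> u} - {\<phi> p}. branch_sum E c col n (\<phi> u) x)
      = (\<Sum>x\<in>E `` {u} - {p}. branch_sum E c col n (\<phi> u) (\<phi> x))"
    using inj_on_subset[OF inj sub] by (simp add: sum.reindex)
  also have "\<dots> = (\<Sum>x\<in>E `` {u} - {p}. branch_sum E c col n u x)"
    using Suc sub by (intro sum.cong) auto
  finally show ?case using assms(3) Suc.prems by (simp add: preserves_coloring_def)
qed

text \<open>Summing over all neighbours singles out no direction, so this is an invariant of the
  vertex alone; it will separate the root from its possible images.\<close>

lemma graph_automorphism_star_sum: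
  assumes "simple_graph V E" "graph_automorphism V E \<phi>" "preserves_coloring V col \<phi>"
    and "u \<in> V"
  shows "(\<Sum>x\<in>E `` {\<phi> u}. branch_sum E c col n (\<phi> u) x) = (\<Sum>x\<in>E `` {u}. branch_sum E c col n u x)"
proof -
  have sub: "E `` {u} \<subseteq> V" using assms(1) by (auto simp: simple_graph_def)
  have "(\<Sum>x\<in>E `` {\<phi> u}. branch_sum E c col n (\<phi> u) x)
      = (\<Sum>x\<in>E `` {u}. branch_sum E c col n (\<phi> u) (\<phi> x))"
    using inj_on_subset[OF graph_automorphism_inj[OF assms(2)] sub]
      graph_automorphism_neighbours[OF assms(1,2,4)] by (simp add: sum.reindex)
  also have "\<dots> = (\<Sum>x\<in>E `` {u}. branch_sum E c col n u x)"
    using graph_automorphism_branch_sum[OF assms(1,2,3,4)] sub by (intro sum.cong) auto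
  finally show ?thesis .
qed

section \<open>Subsets of a cyclic group with prescribed sum\<close>

text \<open>With m = card S, the sums of {0, ..., m} minus one positive element are m consecutive
  integers, and translation by q adds m q, so every residue occurs. Strictness of
  \<open>card S < N\<close> leaves room for the omitted element.\<close>

lemma inj_with_sum_cong:
  fixes S :: "'b set" and N s :: nat
  assumes "finite S" "S \<noteq> {}" "card S < N"
  shows "\<exists>g. inj_on g S \<and> g ` S \<subseteq> {..<N} \<and> [(\<Sum>x\<in>S. g x) = s] (mod N)"
proof -
  define m where "m = card S"
  have m: "0 < m" "m < N" using assms by (auto simp: m_def card_gt_0_iff)
  obtain h where h: "bij_betw h S {0..<m}"
    using ex_bij_betw_finite_nat[OF assms(1)] by (auto simp: m_def)
  \<comment> \<open>Modulo \<open>N\<close> the factor \<open>N - 1\<close> acts as -1, so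
    \<open>j\<close> is what must be added to 0 + ... + (m - 1). It splits into a translation by
    \<open>q\<close> and a remainder \<open>t < m\<close>.\<close>
  define j where "j = s + (N - 1) * (\<Sum>i<m. i)"
  define q where "q = j div m"
  define t where "t = j mod m"
  have t: "t < m" using m by (simp add: t_def)
  \<comment> \<open>On i < m this enumerates {0, ..., m} without m - t, which raises the sum by
    exactly \<open>t\<close>.\<close>
  define f where "f i = i + (if m - t \<le> i then 1 else 0)" for i
  have f_le: "f i \<le> m" if "i < m" for i using that by (simp add: f_def)
  have f_inj: "inj f" by (auto simp: f_def inj_def split: if_splits)
  define g where "g x = (f (h x) + q) mod N" for x
  have hm: "h x < m" if "x \<in> S" for x using h that by (auto simp: bij_betw_def)
  have "inj_on g S"
  proof (rule inj_onI)
    fix x y assume xy: "x \<in> S" "y \<in> S" "g x = g y"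
    then have "[f (h x) + q = f (h y) + q] (mod N)" by (simp add: g_def cong_def)
    then have "[f (h x) = f (h y)] (mod N)" by (simp add: cong_add_rcancel_nat)
    moreover have "f (h x) < N" "f (h y) < N" using f_le hm xy m(2) by (meson le_less_trans)+
    ultimately have "f (h x) = f (h y)" by (simp add: cong_def)
    then have "h x = h y" using f_inj by (auto dest: injD)
    then show "x = y" using h xy by (auto simp: bij_betw_def dest: inj_onD)
  qed
  moreover have "g ` S \<subseteq> {..<N}" using m by (auto simp: g_def)
  moreover have "[(\<Sum>x\<in>S. g x) = s] (mod N)"
  proof -
    have "[(\<Sum>x\<in>S. g x) = (\<Sum>x\<in>S. f (h x) + q)] (mod N)"
      by (rule cong_sum) (simp add: g_def cong_def)
    also have "(\<Sum>x\<in>S. f (h x) + q) = (\<Sum>i<m. f i + q)"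
      using sum.reindex_bij_betw[OF h, of "\<lambda>i. f i + q"] by (simp add: atLeast0LessThan)
    also have "\<dots> = (\<Sum>i<m. i) + (\<Sum>i<m. if m - t \<le> i then 1 else 0) + m * q"
      by (simp add: f_def sum.distrib)
    also have "(\<Sum>i<m. if m - t \<le> i then 1 else (0::nat)) = card ({..<m} \<inter> {i. m - t \<le> i})"
      by (simp add: sum.If_cases)
    also have "{..<m} \<inter> {i. m - t \<le> i} = {m - t..<m}" by auto
    also have "(\<Sum>i<m. i) + card {m - t..<m} + m * q = (\<Sum>i<m. i) + j"
      using t by (simp add: q_def t_def)
    also have "\<dots> = s + N * (\<Sum>i<m. i)"
      using m by (cases N) (auto simp: j_def)
    also have "[\<dots> = s] (mod N)" by (simp add: cong_def)
    finally show ?thesis .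
  qed
  ultimately show ?thesis by blast
qed

section \<open>Rooted trees\<close>

locale rooted_tree =
  fixes V :: "'a set" and E :: "('a \<times> 'a) set" and v :: 'a
  assumes tree: "is_tree V E" and root_in: "v \<in> V"
begin

lemma graph: "simple_graph V E" and symE: "sym E" and edge_in: "(x, y) \<in> E \<Longrightarrow> x \<in> V \<and> y \<in> V"
  and edge_neq: "(x, y) \<in> E \<Longrightarrow> x \<noteq> y"
  using tree by (auto simp: is_tree_def simple_graph_def irrefl_def)

lemma edge_commute: "(x, y) \<in> E \<longleftrightarrow> (y, x) \<in> E"
  using symE by (meson symD)

definition depth :: "'a \<Rightarrow> nat" where
  "depth x = (LEAST n. (v, x) \<in> E ^^ n)"

lemma relpow_depth: "x \<in> V \<Longrightarrow> (v, x) \<in> E ^^ depth x"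
proof -
  assume "x \<in> V"
  then obtain p where "path_between E v p x" using tree root_in unfolding is_tree_def by blast
  then show ?thesis unfolding depth_def using path_between_imp_relpow by (metis LeastI)
qed

lemma depth_le: "(v, x) \<in> E ^^ n \<Longrightarrow> depth x \<le> n"
  unfolding depth_def by (rule Least_le)

lemma depth_edge: "(x, y) \<in> E \<Longrightarrow> depth y \<le> Suc (depth x)"
  by (meson depth_le edge_in relpow_Suc_I relpow_depth)

lemma depth_root: "depth v = 0"
  using depth_le[of v 0] by simp

lemma depth_eq_0: "x \<in> V \<Longrightarrow> depth x = 0 \<Longrightarrow> x = v"
  using relpow_depth[of x] by simp

lemma ex_parent:
  assumes "x \<in> V" "x \<noteq> v"
  shows "\<exists>y. (y, x) \<in> E \<and> depth x = Suc (depth y)"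
proof -
  obtain n where n: "depth x = Suc n" using depth_eq_0 assms by (cases "depth x") auto
  with relpow_depth[OF assms(1)] obtain y where y: "(v, y) \<in> E ^^ n" "(y, x) \<in> E" by auto
  then have "depth y \<le> n" by (simp add: depth_le)
  with depth_edge[OF y(2)] n y show ?thesis by (intro exI[of _ y]) auto
qed

text \<open>Climbing from \<open>y\<close> to the root, all later vertices have depth below that of
  \<open>x\<close>.\<close>

lemma root_walk_avoiding:
  assumes "y \<in> V" "y \<noteq> x" "depth y \<le> depth x"
  shows "(v, y) \<in> (E \<inter> (- {x}) \<times> (- {x}))\<^sup>*"
  using assms
proof (induction "depth y" arbitrary: y rule: less_induct)
  case less
  show ?case
  proof (cases "y = v")
    case False
    with less ex_parent obtain z where z: "(z, y) \<in> E" "depth y = Suc (depth z)" by blast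
    then have "z \<noteq> x" using less by auto
    with z less edge_in have "(v, z) \<in> (E \<inter> (- {x}) \<times> (- {x}))\<^sup>*" by auto
    moreover have "(z, y) \<in> E \<inter> (- {x}) \<times> (- {x})" using z \<open>z \<noteq> x\<close> less by auto
    ultimately show ?thesis by (rule rtrancl.rtrancl_into_rtrancl)
  qed simp
qed

text \<open>Both neighbours reach the root without passing \<open>x\<close>, which would be a
  detour. The non-strict bounds also exclude edges within one level, so every neighbour is a parent
  or a child.\<close>

lemma parent_unique:
  assumes "(y, x) \<in> E" "(z, x) \<in> E" "depth y \<le> depth x" "depth z \<le> depth x"
  shows "y = z"
proof (rule ccontr)
  assume neq: "y \<noteq> z"
  let ?R = "E \<inter> (- {x}) \<times> (- {x})"
  have "(v, y) \<in> ?R\<^sup>*" "(v, z) \<in> ?R\<^sup>*"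
    using root_walk_avoiding assms edge_in edge_neq by blast+
  moreover have "sym ?R" using edge_commute by (auto simp: sym_def)
  ultimately have "(y, z) \<in> ?R\<^sup>*" by (meson rtrancl_trans symD sym_rtrancl)
  with tree_no_detour[OF tree assms(1,2) neq] show False by blast
qed

definition parent :: "'a \<Rightarrow> 'a" where
  "parent x = (SOME y. (y, x) \<in> E \<and> depth x = Suc (depth y))"

lemma parent:
  assumes "x \<in> V" "x \<noteq> v"
  shows "(parent x, x) \<in> E" "depth x = Suc (depth (parent x))" "parent x \<in> V"
proof -
  show *: "(parent x, x) \<in> E" "depth x = Suc (depth (parent x))"
    using someI_ex[OF ex_parent[OF assms]] by (auto simp: parent_def)
  then show "parent x \<in> V" using edge_in by blast
qed

definition children :: "'a \<Rightarrow> 'a set" where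
  "children u = {x. (u, x) \<in> E \<and> depth u < depth x}"

lemma childrenD:
  assumes "x \<in> children u"
  shows "(u, x) \<in> E" "u \<in> V" "x \<in> V" "x \<noteq> v" "parent x = u" "depth x = Suc (depth u)"
proof -
  show ux: "(u, x) \<in> E" "u \<in> V" "x \<in> V" using assms edge_in by (auto simp: children_def)
  have d: "depth u < depth x" using assms by (simp add: children_def)
  then show "x \<noteq> v" by (auto simp: depth_root)
  with ux parent[of x] d show "parent x = u" by (intro parent_unique[of _ x]) auto
  show "depth x = Suc (depth u)" using d depth_edge[OF ux(1)] by simp
qed

lemma in_children_parent: "x \<in> V \<Longrightarrow> x \<noteq> v \<Longrightarrow> x \<in> children (parent x)"
  using parent[of x] by (simp add: children_def)

lemma neighbours_root: "E `` {v} = children v"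
proof -
  have "depth v < depth x" if "(v, x) \<in> E" for x
    using that depth_eq_0[of x] edge_in edge_neq depth_root by fastforce
  then show ?thesis by (auto simp: children_def)
qed

lemma neighbours_nonroot:
  assumes "u \<in> V" "u \<noteq> v"
  shows "E `` {u} = insert (parent u) (children u)" "parent u \<notin> children u"
proof -
  show "parent u \<notin> children u" using parent[OF assms] by (auto simp: children_def)
  have "x = parent u" if "(u, x) \<in> E" "\<not> depth u < depth x" for x
    using that parent[OF assms] edge_commute by (intro parent_unique[of _ u]) auto
  then show "E `` {u} = insert (parent u) (children u)"
    using parent[OF assms] edge_commute by (auto simp: children_def)
qed

lemma neighbours_minus_parent: "u \<in> V \<Longrightarrow> u \<noteq> v \<Longrightarrow> E `` {u} - {parent u} = children u"
  using neighbours_nonroot by blast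

lemma heavy_parent_of_child:
  assumes "x \<in> children u" "u \<noteq> v" "heavy E M u x"
  shows "heavy E M (parent u) u"
proof (rule heavy.step)
  show "(u, x) \<in> E" using childrenD[OF assms(1)] by blast
  show "x \<noteq> parent u" using neighbours_nonroot assms childrenD[OF assms(1)] by blast
qed (rule assms)

text \<open>The climb from \<open>x\<close> to the root never turns back and ends in
  \<open>M\<close>.\<close>

lemma heavy_towards_root:
  assumes "v \<in> M" "x \<in> V" "x \<noteq> v"
  shows "heavy E M x (parent x)"
  using assms(2,3)
proof (induction "depth x" arbitrary: x rule: less_induct)
  case less
  show ?case
  proof (cases "parent x = v")
    case True
    then show ?thesis using assms(1) by (auto intro: heavy.here)
  next
    case False
    have p: "parent x \<in> V" "depth x = Suc (depth (parent x))" using parent less by auto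
    have pp: "(parent (parent x), parent x) \<in> E"
      "depth (parent x) = Suc (depth (parent (parent x)))"
      using parent[OF p(1) False] by auto
    have "heavy E M (parent x) (parent (parent x))" using less p False by auto
    moreover have "parent (parent x) \<noteq> x" using p pp by auto
    ultimately show ?thesis using pp(1) edge_commute by (blast intro: heavy.step)
  qed
qed

end

text \<open>Root the tree at some \<open>a\<close> in \<open>M\<close>. If another \<open>x\<close>
  in \<open>M\<close> were not adjacent to \<open>a\<close>, its parent would have heavy branches
  both towards \<open>x\<close> and towards \<open>a\<close>. So the rest of \<open>M\<close>
  consists of neighbours of \<open>a\<close>, and two of them would give two heavy branches at
  \<open>a\<close>.\<close>

lemma few_targets:
  assumes tree: "is_tree V E" and "M \<subseteq> V"
    and no_two: "\<And>w x y. (w, x) \<in> E \<Longrightarrow> (w, y) \<in> E \<Longrightarrow> heavy E M w x \<Longrightarrow> heavy E M w y \<Longrightarrow> x = y"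
  shows "\<exists>a b. M \<subseteq> {a, b}"
proof (cases "M = {}")
  case False
  then obtain a where a: "a \<in> M" by blast
  interpret rooted_tree V E a
    by unfold_locales (use a assms in auto)
  have nb: "(a, x) \<in> E" if x: "x \<in> M" "x \<noteq> a" for x
  proof (rule ccontr)
    assume "(a, x) \<notin> E"
    define p where "p = parent x"
    have xV: "x \<in> V" using x assms(2) by auto
    have p: "(p, x) \<in> E" "depth x = Suc (depth p)" "p \<in> V" using parent xV x by (auto simp: p_def)
    with \<open>(a, x) \<notin> E\<close> have "p \<noteq> a" by auto
    note pp = parent[OF p(3) this]
    have "heavy E M p (parent p)" using heavy_towards_root[OF a p(3) \<open>p \<noteq> a\<close>] .
    moreover have "heavy E M p x" using x by (blast intro: heavy.here)
    ultimately have "x = parent p" using no_two[of p x "parent p"] p pp edge_commute by blast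
    with p pp show False by simp
  qed
  have "x = y" if "x \<in> M - {a}" "y \<in> M - {a}" for x y
    using that nb no_two[of a x y] by (auto intro: heavy.here)
  then have "\<exists>b. M - {a} \<subseteq> {b}" by (cases "M - {a} = {}") blast+
  then show ?thesis by blast
qed auto

section \<open>The distinguishing coloring\<close>

text \<open>By \<open>two_heavy\<close>, any image of the root other than the root itself still has
  a heavy branch away from its parent.\<close>

locale branching_rooted_tree = rooted_tree V E v for V :: "'a set" and E v +
  fixes c r :: nat and M :: "'a set"
  assumes c_ge_2: "2 \<le> c"
    and finite_neighbours: "x \<in> V \<Longrightarrow> finite (E `` {x})"
    and card_neighbours: "x \<in> V \<Longrightarrow> card (E `` {x}) \<le> c ^ Suc r"
    and M_leaf_free: "x \<in> M \<Longrightarrow> leaf_free V E r x"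
    and two_heavy: "\<exists>x y. x \<noteq> y \<and> (v, x) \<in> E \<and> (v, y) \<in> E \<and> heavy E M v x \<and> heavy E M v y"
begin

section \<open>Labellings of the children of a single vertex\<close>

definition heavy_children :: "'a \<Rightarrow> 'a set" where
  "heavy_children u = {x \<in> children u. heavy E M u x}"

lemma heavy_children_subset: "heavy_children u \<subseteq> children u"
  by (auto simp: heavy_children_def)

lemma finite_children: "u \<in> V \<Longrightarrow> finite (children u)"
  by (rule finite_subset[OF _ finite_neighbours]) (auto simp: children_def)

lemma finite_heavy_children: "u \<in> V \<Longrightarrow> finite (heavy_children u)"
  using finite_children heavy_children_subset by (rule finite_subset[rotated])

lemma card_heavy_children_root: "card (heavy_children v) \<le> c ^ Suc r"
proof -
  have "card (heavy_children v) \<le> card (E `` {v})"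
    using finite_neighbours root_in by (intro card_mono) (auto simp: heavy_children_def children_def)
  with card_neighbours[OF root_in] show ?thesis by linarith
qed

text \<open>The parent takes up one neighbour. The strict bound is what prescribing the sum of
  distinct residues requires; at the root all residues may be used up, so its sum is left as it
  comes.\<close>

lemma card_heavy_children_nonroot:
  assumes "u \<in> V" "u \<noteq> v"
  shows "card (heavy_children u) < c ^ Suc r"
proof -
  have "heavy_children u \<subset> E `` {u}"
    using neighbours_nonroot[OF assms] by (auto simp: heavy_children_def)
  then have "card (heavy_children u) < card (E `` {u})"
    using finite_neighbours assms by (intro psubset_card_mono) auto
  with card_neighbours[OF assms(1)] show ?thesis by linarith
qed

definition root_labelling :: "'a \<Rightarrow> nat" where
  "root_labelling = (SOME g. inj_on g (heavy_children v) \<and> g ` heavy_children v \<subseteq> {..<c ^ Suc r} \<and>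
     (\<forall>x\<in>children v - heavy_children v. g x = 0))"

lemma root_labelling:
  "inj_on root_labelling (heavy_children v)"
  "root_labelling ` heavy_children v \<subseteq> {..<c ^ Suc r}"
  "\<And>x. x \<in> children v - heavy_children v \<Longrightarrow> root_labelling x = 0"
proof -
  let ?S = "heavy_children v"
  obtain f where f: "inj_on f ?S" "f ` ?S \<subseteq> {..<c ^ Suc r}"
    using inj_on_iff_card_le[of ?S "{..<c ^ Suc r}"] card_heavy_children_root
      finite_heavy_children[OF root_in] by auto
  define g where "g x = (if x \<in> ?S then f x else 0)" for x
  have "inj_on g ?S" using f(1) by (auto simp: g_def inj_on_def)
  moreover have "g ` ?S \<subseteq> {..<c ^ Suc r}" using f(2) by (auto simp: g_def)
  moreover have "\<forall>x\<in>children v - ?S. g x = 0" by (simp add: g_def)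
  ultimately have "\<exists>g. inj_on g ?S \<and> g ` ?S \<subseteq> {..<c ^ Suc r} \<and> (\<forall>x\<in>children v - ?S. g x = 0)"
    by blast
  from someI_ex[OF this] show
    "inj_on root_labelling (heavy_children v)"
    "root_labelling ` heavy_children v \<subseteq> {..<c ^ Suc r}"
    "\<And>x. x \<in> children v - heavy_children v \<Longrightarrow> root_labelling x = 0"
    by (auto simp: root_labelling_def)
qed

definition root_sum :: nat where
  "root_sum = (\<Sum>x\<in>children v. root_labelling x)"

text \<open>The label of \<open>u\<close> prescribes \<open>branch_sum E c _ r (parent u) u\<close> modulo \<open>c ^ Suc r\<close>: its last
  base-\<open>c\<close> digit is the color of \<open>u\<close>, and the remaining digits prescribe the sum of the labels
  of the children modulo \<open>c ^ r\<close>. This leaves \<open>c\<close> choices for the sum modulo \<open>c ^ Suc r\<close>, so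
  \<open>root_sum\<close> can be avoided. In \<open>admissible u a w g\<close>, \<open>a\<close> is the label of \<open>u\<close>, \<open>w\<close> is the
  branch sum from \<open>u\<close> towards its parent, and \<open>g\<close> labels the children.\<close>

definition admissible :: "'a \<Rightarrow> nat \<Rightarrow> nat \<Rightarrow> ('a \<Rightarrow> nat) \<Rightarrow> bool" where
  "admissible u a w g \<longleftrightarrow>
     inj_on g (heavy_children u) \<and> g ` heavy_children u \<subseteq> {..<c ^ Suc r} \<and>
     (heavy_children u \<noteq> {} \<longrightarrow> (\<forall>x\<in>children u - heavy_children u. g x = 0) \<and>
        \<not> [w + (\<Sum>x\<in>children u. g x) = root_sum] (mod c ^ Suc r)) \<and>
     (heavy_children u = {} \<and> a = 0 \<longrightarrow> (\<forall>x\<in>children u. g x = 0)) \<and>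
     (children u \<noteq> {} \<longrightarrow> [(\<Sum>x\<in>children u. g x) = a div c] (mod c ^ r))"

lemma ex_admissible:
  assumes u: "u \<in> V" "u \<noteq> v"
  shows "\<exists>g. admissible u a w g"
proof (cases "heavy_children u = {}")
  case True
  show ?thesis
  proof (cases "children u = {}")
    case True
    then show ?thesis using \<open>heavy_children u = {}\<close> by (auto simp: admissible_def)
  next
    case False
    then obtain z where z: "z \<in> children u" by blast
    \<comment> \<open>One child carries the whole sum; for a = 0 all labels vanish, as
      \<open>admissible\<close> demands.\<close>
    define g where "g x = (if x = z then a div c else 0)" for x
    have "(\<Sum>x\<in>children u. g x) = a div c"
      using z finite_children[OF u(1)] by (simp add: g_def)
    then have "admissible u a w g" using True by (auto simp: admissible_def g_def)
    then show ?thesis by blast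
  qed
next
  case False
  let ?S = "heavy_children u"
  let ?N = "c ^ Suc r"
  have c: "0 < c" "1 < c" using c_ge_2 by auto
  \<comment> \<open>The candidates a div c and a div c + c^r agree modulo c^r but differ modulo
    c^(r+1), so they cannot both produce \<open>root_sum\<close>.\<close>
  have "\<exists>s. [s = a div c] (mod c ^ r) \<and> \<not> [w + s = root_sum] (mod ?N)"
  proof (rule ccontr)
    assume no: "\<not> ?thesis"
    have "[w + a div c = root_sum] (mod ?N)" using no by auto
    moreover have "[w + (a div c + c ^ r) = root_sum] (mod ?N)"
      using no by (auto simp: cong_def)
    ultimately have "[(w + a div c) + c ^ r = (w + a div c) + 0] (mod ?N)"
      by (metis add.assoc add.right_neutral cong_sym cong_trans)
    then have "[c ^ r = 0] (mod ?N)" by (simp only: cong_add_lcancel_nat)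
    moreover have "c ^ r < ?N" "0 < c ^ r" using c by auto
    ultimately show False by (simp add: cong_def)
  qed
  then obtain s where s: "[s = a div c] (mod c ^ r)" "\<not> [w + s = root_sum] (mod ?N)" by blast
  obtain f where f: "inj_on f ?S" "f ` ?S \<subseteq> {..<?N}" "[(\<Sum>x\<in>?S. f x) = s] (mod ?N)"
    using inj_with_sum_cong[OF finite_heavy_children[OF u(1)] False
        card_heavy_children_nonroot[OF u]] by blast
  define g where "g x = (if x \<in> ?S then f x else 0)" for x
  have inj: "inj_on g ?S" using f(1) by (auto simp: g_def inj_on_def)
  have ran: "g ` ?S \<subseteq> {..<?N}" using f(2) by (auto simp: g_def)
  have "(\<Sum>x\<in>children u. g x) = (\<Sum>x\<in>?S. g x)"
    using finite_children[OF u(1)] heavy_children_subset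
    by (intro sum.mono_neutral_right) (auto simp: g_def)
  also have "\<dots> = (\<Sum>x\<in>?S. f x)" by (simp add: g_def)
  finally have sum: "[(\<Sum>x\<in>children u. g x) = s] (mod ?N)" using f(3) by simp
  then have "\<not> [w + (\<Sum>x\<in>children u. g x) = root_sum] (mod ?N)"
    using s(2) by (meson cong_add_lcancel_nat cong_sym cong_trans)
  moreover have "[(\<Sum>x\<in>children u. g x) = a div c] (mod c ^ r)"
    using sum s(1) by (meson cong_dvd_modulus_nat cong_trans le_imp_power_dvd le_SucI order_refl)
  ultimately have "admissible u a w g"
    using inj ran False by (simp add: admissible_def g_def)
  then show ?thesis by blast
qed

section \<open>Recursive labelling and the coloring read off from it\<close>

definition child_labelling :: "'a \<Rightarrow> nat \<Rightarrow> nat \<Rightarrow> 'a \<Rightarrow> nat" where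
  "child_labelling u a w = (if u = v then root_labelling else SOME g. admissible u a w g)"

text \<open>Recursion on a number meant to be the depth of \<open>x\<close>. The second component
  predicts the branch sum from \<open>x\<close> towards its parent \<open>u\<close>: the color of
  \<open>u\<close>, plus \<open>c\<close> times the prediction beyond \<open>u\<close> and the
  labels of the siblings. The root has nothing above it and starts with zeros.\<close>

primrec labels_at :: "nat \<Rightarrow> 'a \<Rightarrow> nat \<times> nat" where
  "labels_at 0 x = (0, 0)"
| "labels_at (Suc n) x =
     (let u = parent x; (a, w) = labels_at n u; g = child_labelling u a w
      in (g x, a mod c + c * (w + (\<Sum>y\<in>children u - {x}. g y))))"

definition label :: "'a \<Rightarrow> nat" where
  "label x = fst (labels_at (depth x) x)"

definition up_label :: "'a \<Rightarrow> nat" where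
  "up_label x = snd (labels_at (depth x) x)"

definition color :: "'a \<Rightarrow> nat" where
  "color x = label x mod c"

lemma label_child: "x \<in> children u \<Longrightarrow> label x = child_labelling u (label u) (up_label u) x"
  by (simp add: label_def up_label_def childrenD Let_def split: prod.split)

lemma up_label_root: "up_label v = 0"
  by (simp add: up_label_def depth_root)

lemma up_label_child:
  assumes "x \<in> children u"
  shows "up_label x = color u + c * (up_label u + (\<Sum>y\<in>children u - {x}. label y))"
proof -
  have "(\<Sum>y\<in>children u - {x}. label y)
      = (\<Sum>y\<in>children u - {x}. child_labelling u (label u) (up_label u) y)"
    by (rule sum.cong) (auto simp: label_child)
  then show ?thesis
    using assms by (simp add: color_def label_def up_label_def childrenD Let_def split: prod.split)
qed

lemma admissible_label:
  assumes "u \<in> V" "u \<noteq> v"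
  shows "admissible u (label u) (up_label u) label"
proof -
  let ?g = "child_labelling u (label u) (up_label u)"
  have adm: "admissible u (label u) (up_label u) ?g"
    using someI_ex[OF ex_admissible[OF assms]] assms(2) by (simp add: child_labelling_def)
  have eq: "label x = ?g x" if "x \<in> children u" for x using label_child[OF that] .
  have sum: "(\<Sum>x\<in>children u. label x) = (\<Sum>x\<in>children u. ?g x)"
    using eq by (rule sum.cong[OF refl])
  have inj: "inj_on label (heavy_children u) = inj_on ?g (heavy_children u)"
    using eq heavy_children_subset by (intro inj_on_cong) blast
  have img: "label ` heavy_children u = ?g ` heavy_children u"
    using eq heavy_children_subset by (intro image_cong) blast+
  show ?thesis using adm eq unfolding admissible_def sum inj img by simp
qed

lemma heavy_labels:
  assumes "u \<in> V"
  shows "inj_on label (heavy_children u)" "label ` heavy_children u \<subseteq> {..<c ^ Suc r}"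
proof -
  have "inj_on label (heavy_children u) \<and> label ` heavy_children u \<subseteq> {..<c ^ Suc r}"
  proof (cases "u = v")
    case True
    have eq: "label x = root_labelling x" if "x \<in> heavy_children v" for x
      using that label_child[of x v] by (simp add: heavy_children_def child_labelling_def)
    show ?thesis
      using root_labelling(1,2) inj_on_cong[of "heavy_children v", OF eq]
        image_cong[of "heavy_children v", OF refl eq] True by simp
  next
    case False
    then show ?thesis using admissible_label[OF assms] by (simp add: admissible_def)
  qed
  then show "inj_on label (heavy_children u)" "label ` heavy_children u \<subseteq> {..<c ^ Suc r}"
    by auto
qed

lemma heavy_children_root: "heavy_children v \<noteq> {}"
  using two_heavy neighbours_root by (auto simp: heavy_children_def)

lemma light_label:
  assumes "x \<in> children u" "\<not> heavy E M u x" "heavy_children u \<noteq> {}"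
  shows "label x = 0"
proof -
  have x: "x \<in> children u - heavy_children u" using assms by (simp add: heavy_children_def)
  show ?thesis
  proof (cases "u = v")
    case True
    then show ?thesis
      using x root_labelling(3)[of x] label_child[OF assms(1)] by (simp add: child_labelling_def)
  next
    case False
    then show ?thesis
      using x assms(3) admissible_label[of u] childrenD[OF assms(1)] by (simp add: admissible_def)
  qed
qed

section \<open>Agreement of labels with branch sums\<close>

abbreviation weight :: "nat \<Rightarrow> 'a \<Rightarrow> 'a \<Rightarrow> nat" where
  "weight \<equiv> branch_sum E c color"

text \<open>A zero label spreads through a light branch, coloring it entirely with 0. Light siblings
  of heavy branches may end too early to realize a prescribed sum, but zero is realized whatever
  their shape.\<close>

lemma weight_light_zero:
  assumes "u \<in> V" "u \<noteq> v" "\<not> heavy E M (parent u) u" "label u = 0"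
  shows "weight n (parent u) u = 0"
  using assms
proof (induction n arbitrary: u)
  case 0
  then show ?case by (simp add: color_def)
next
  case (Suc n)
  have light: "\<not> heavy E M u x" if "x \<in> children u" for x
    using that Suc.prems heavy_parent_of_child by blast
  then have "heavy_children u = {}" by (auto simp: heavy_children_def)
  then have "label x = 0" if "x \<in> children u" for x
    using that Suc.prems admissible_label[OF Suc.prems(1,2)] by (simp add: admissible_def)
  then have "weight n u x = 0" if "x \<in> children u" for x
    using that Suc.IH[of x] light childrenD[OF that] by auto
  moreover have "color u = 0" using Suc.prems(4) by (simp add: color_def)
  ultimately show ?case using neighbours_minus_parent Suc.prems by simp
qed

text \<open>Each level realizes one more base-\<open>c\<close> digit of the label, so the branch
  must not stop early. Its being heavy or free of nearby leaves guarantees a child at every level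
  that needs one.\<close>

lemma weight_eq_label:
  assumes "n \<le> r" "u \<in> V" "u \<noteq> v" "heavy E M (parent u) u \<or> leaf_free V E n u"
  shows "[weight n (parent u) u = label u] (mod c ^ Suc n)"
  using assms
proof (induction n arbitrary: u)
  case 0
  then show ?case by (simp add: color_def cong_def)
next
  case (Suc n)
  note u = Suc.prems(2,3)
  \<comment> \<open>A heavy branch without heavy children has its root in \<open>M\<close>, hence
    far enough from the leaves.\<close>
  have no_heavy: "leaf_free V E (Suc n) u" if "heavy_children u = {}"
  proof (cases "heavy E M (parent u) u")
    case True
    then have "u \<in> M"
    proof (cases rule: heavy.cases)
      case (step x)
      then have "x \<in> heavy_children u"
        using neighbours_minus_parent[OF u] by (auto simp: heavy_children_def)
      with that show ?thesis by simp
    qed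
    then show ?thesis by (rule leaf_free_mono[OF M_leaf_free Suc.prems(1)])
  qed (use Suc.prems(4) in blast)
  have "children u \<noteq> {}"
  proof (cases "heavy_children u = {}")
    case True
    have "u \<notin> leaves V E" by (rule leaf_free_Suc_not_leaf[OF no_heavy[OF True]])
    then show ?thesis using u neighbours_nonroot[OF u] by (auto simp: leaves_def valence_def)
  qed (use heavy_children_subset in blast)
  then have sum: "[(\<Sum>x\<in>children u. label x) = label u div c] (mod c ^ r)"
    using admissible_label[OF u] by (simp add: admissible_def)
  have "[weight n u x = label x] (mod c ^ Suc n)" if x: "x \<in> children u" for x
  proof -
    note cx = childrenD[OF x]
    have IH: "[weight n u x = label x] (mod c ^ Suc n)"
      if "heavy E M u x \<or> leaf_free V E n x"
      using Suc.IH[OF _ cx(3,4)] Suc.prems(1) cx(5) that by simp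
    show ?thesis
    proof (cases "heavy E M u x \<or> heavy_children u = {}")
      case True
      then have "heavy E M u x \<or> leaf_free V E n x"
        using leaf_free_Suc_neighbour[OF no_heavy cx(1)] by auto
      then show ?thesis by (rule IH)
    next
      case False
      then show ?thesis
        using weight_light_zero[OF cx(3,4), of n] cx(5) light_label[OF x] by simp
    qed
  qed
  then have "[(\<Sum>x\<in>children u. weight n u x) = (\<Sum>x\<in>children u. label x)] (mod c ^ Suc n)"
    by (rule cong_sum)
  moreover have "[(\<Sum>x\<in>children u. label x) = label u div c] (mod c ^ Suc n)"
    using sum Suc.prems(1) by (meson cong_dvd_modulus_nat le_imp_power_dvd)
  ultimately have "[(\<Sum>x\<in>children u. weight n u x) = label u div c] (mod c ^ Suc n)"
    by (rule cong_trans)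
  \<comment> \<open>The factor \<open>c\<close> shifts the digits by one place and raises the
    modulus by one power of \<open>c\<close>.\<close>
  then have "[c * (\<Sum>x\<in>children u. weight n u x) = c * (label u div c)] (mod c * c ^ Suc n)"
    by (rule cong_cmult_leftI)
  then have "[color u + c * (\<Sum>x\<in>children u. weight n u x) = color u + c * (label u div c)]
      (mod c * c ^ Suc n)"
    by (simp only: cong_add_lcancel_nat)
  moreover have "color u + c * (label u div c) = label u" by (simp add: color_def)
  ultimately show ?case using neighbours_minus_parent[OF u] by simp
qed

lemma weight_child:
  assumes "n \<le> r" "x \<in> children u" "heavy_children u \<noteq> {}"
  shows "[weight n u x = label x] (mod c ^ Suc n)"
proof (cases "heavy E M u x")
  case True
  then show ?thesis using weight_eq_label[of n x] assms childrenD[OF assms(2)] by simp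
next
  case False
  then show ?thesis
    using weight_light_zero[of x n] light_label[of x u] assms childrenD[OF assms(2)] by simp
qed

text \<open>Seen from \<open>u\<close>, the branch at its parent consists of the parent, the
  siblings of \<open>u\<close> and the branch beyond. Since \<open>u\<close> is heavy,
  \<open>weight_child\<close> evaluates the siblings; the branch beyond is covered by induction, or
  absent at the root.\<close>

lemma weight_eq_up_label:
  assumes "n \<le> r" "u \<in> V" "u \<noteq> v" "heavy E M (parent u) u"
  shows "[weight n u (parent u) = up_label u] (mod c ^ Suc n)"
  using assms
proof (induction n arbitrary: u)
  case 0
  have "up_label u = color (parent u) + c * (up_label (parent u) + (\<Sum>y\<in>children (parent u) - {u}. label y))"
    using 0 by (intro up_label_child in_children_parent)
  then show ?case by (simp add: cong_def)
next
  case (Suc n)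
  define p where "p = parent u"
  have u: "u \<in> children p" using Suc.prems in_children_parent by (simp add: p_def)
  note pu = childrenD[OF u]
  have hp: "heavy_children p \<noteq> {}" using u Suc.prems by (auto simp: heavy_children_def p_def)
  have sib: "[(\<Sum>x\<in>children p - {u}. weight n p x) = (\<Sum>x\<in>children p - {u}. label x)] (mod c ^ Suc n)"
    using Suc.prems(1) hp by (intro cong_sum weight_child) auto
  have "[(\<Sum>x\<in>E `` {p} - {u}. weight n p x)
      = up_label p + (\<Sum>x\<in>children p - {u}. label x)] (mod c ^ Suc n)"
  proof (cases "p = v")
    case True
    then show ?thesis using sib by (simp add: neighbours_root up_label_root)
  next
    case False
    have "heavy E M (parent p) p"
      using heavy_parent_of_child[OF u False] Suc.prems by (simp add: p_def)
    then have up: "[weight n p (parent p) = up_label p] (mod c ^ Suc n)"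
      using Suc.IH[of p] Suc.prems(1) pu False by simp
    have "E `` {p} - {u} = insert (parent p) (children p - {u})" "parent p \<notin> children p"
      using neighbours_nonroot[OF pu(2) False] u by auto
    then show ?thesis
      using cong_add[OF up sib] finite_children[OF pu(2)] by simp
  qed
  then have "[c * (\<Sum>x\<in>E `` {p} - {u}. weight n p x)
      = c * (up_label p + (\<Sum>x\<in>children p - {u}. label x))] (mod c * c ^ Suc n)"
    by (rule cong_cmult_leftI)
  then have "[color p + c * (\<Sum>x\<in>E `` {p} - {u}. weight n p x)
      = color p + c * (up_label p + (\<Sum>x\<in>children p - {u}. label x))] (mod c * c ^ Suc n)"
    by (simp only: cong_add_lcancel_nat)
  then show ?case
    using up_label_child[OF u] by (simp add: p_def)
qed

lemma star_weight_root: "[(\<Sum>x\<in>E `` {v}. weight r v x) = root_sum] (mod c ^ Suc r)"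
proof -
  have "[(\<Sum>x\<in>E `` {v}. weight r v x) = (\<Sum>x\<in>children v. label x)] (mod c ^ Suc r)"
    unfolding neighbours_root using heavy_children_root by (intro cong_sum weight_child) auto
  also have "(\<Sum>x\<in>children v. label x) = root_sum"
    unfolding root_sum_def using label_child by (intro sum.cong) (auto simp: child_labelling_def)
  finally show ?thesis .
qed

text \<open>The star sum is the upward prediction plus the labels of the children, exactly the
  quantity that \<open>admissible\<close> keeps away from \<open>root_sum\<close>.\<close>

lemma star_weight_nonroot:
  assumes u: "u \<in> V" "u \<noteq> v" and hu: "heavy_children u \<noteq> {}"
  shows "\<not> [(\<Sum>x\<in>E `` {u}. weight r u x) = root_sum] (mod c ^ Suc r)"
proof -
  have "heavy E M (parent u) u"
    using hu heavy_parent_of_child u by (auto simp: heavy_children_def)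
  then have "[weight r u (parent u) = up_label u] (mod c ^ Suc r)"
    using weight_eq_up_label u by simp
  moreover have "[(\<Sum>x\<in>children u. weight r u x) = (\<Sum>x\<in>children u. label x)] (mod c ^ Suc r)"
    using hu by (intro cong_sum weight_child) auto
  ultimately have "[weight r u (parent u) + (\<Sum>x\<in>children u. weight r u x)
      = up_label u + (\<Sum>x\<in>children u. label x)] (mod c ^ Suc r)"
    by (rule cong_add)
  then have "[(\<Sum>x\<in>E `` {u}. weight r u x) = up_label u + (\<Sum>x\<in>children u. label x)] (mod c ^ Suc r)"
    using neighbours_nonroot[OF u] finite_children[OF u(1)] by simp
  moreover have "\<not> [up_label u + (\<Sum>x\<in>children u. label x) = root_sum] (mod c ^ Suc r)"
    using admissible_label[OF u] hu by (simp add: admissible_def)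
  ultimately show ?thesis by (meson cong_sym cong_trans)
qed

section \<open>Rigidity under color-preserving automorphisms\<close>

context
  fixes \<phi> :: "'a \<Rightarrow> 'a"
  assumes aut: "graph_automorphism V E \<phi>" and pres: "preserves_coloring V color \<phi>"
    and M_inv: "\<phi> ` M \<subseteq> M"
begin

lemma heavy_image: "(u, x) \<in> E \<Longrightarrow> heavy E M u x \<Longrightarrow> heavy E M (\<phi> u) (\<phi> x)"
  using graph_automorphism_heavy[OF _ graph aut M_inv, of u x] edge_in[of u x] by simp

lemma edge_image: "(u, x) \<in> E \<Longrightarrow> (\<phi> u, \<phi> x) \<in> E"
  using aut edge_in[of u x] by (simp add: graph_automorphism_def)

lemma image_eq_iff: "x \<in> V \<Longrightarrow> y \<in> V \<Longrightarrow> \<phi> x = \<phi> y \<longleftrightarrow> x = y"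
  using graph_automorphism_inj[OF aut] by (auto dest: inj_onD)

text \<open>If the root moved, at most one of its two heavy branches would be sent towards the
  parent of \<open>\<phi> v\<close>. So \<open>\<phi> v\<close> would have a heavy child and a star
  sum different from that of the root.\<close>

lemma root_fixed: "\<phi> v = v"
proof (rule ccontr)
  assume neq: "\<phi> v \<noteq> v"
  have in_V: "\<phi> v \<in> V" using graph_automorphism_in[OF aut root_in] .
  obtain x y where xy: "x \<noteq> y" "(v, x) \<in> E" "(v, y) \<in> E" "heavy E M v x" "heavy E M v y"
    using two_heavy by blast
  then have "\<phi> x \<noteq> \<phi> y" using image_eq_iff[of x y] edge_in by blast
  then have "\<exists>z\<in>{x, y}. \<phi> z \<noteq> parent (\<phi> v)" by auto
  then obtain z where "z \<in> {x, y}" "\<phi> z \<noteq> parent (\<phi> v)" by blast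
  with xy have z: "(v, z) \<in> E" "heavy E M v z" "\<phi> z \<noteq> parent (\<phi> v)" by auto
  then have "\<phi> z \<in> children (\<phi> v)"
    using neighbours_minus_parent[OF in_V neq] edge_image[OF z(1)] by blast
  then have "\<phi> z \<in> heavy_children (\<phi> v)"
    using heavy_image[OF z(1,2)] by (simp add: heavy_children_def)
  then have "\<not> [(\<Sum>x\<in>E `` {\<phi> v}. weight r (\<phi> v) x) = root_sum] (mod c ^ Suc r)"
    using star_weight_nonroot[OF in_V neq] by blast
  then show False
    using star_weight_root graph_automorphism_star_sum[OF graph aut pres root_in, of c r] by simp
qed

text \<open>With the parent \<open>p\<close> fixed, \<open>\<phi> x\<close> is again a neighbour of
  \<open>p\<close>. It is not the parent of \<open>p\<close>, which is already fixed, so it is a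
  heavy child with the same branch sum as \<open>x\<close>; distinct labels force equality.\<close>

lemma heavy_fixed:
  assumes "x \<in> V" "x \<noteq> v" "heavy E M (parent x) x"
  shows "\<phi> x = x"
  using assms
proof (induction "depth x" arbitrary: x rule: less_induct)
  case less
  define p where "p = parent x"
  have x: "x \<in> heavy_children p"
    using less.prems in_children_parent by (simp add: heavy_children_def p_def)
  then have xc: "x \<in> children p" and hx: "heavy E M p x" by (auto simp: heavy_children_def)
  note px = childrenD[OF xc]
  have fixed: "\<phi> y = y" if "y = v \<or> y \<noteq> v \<and> y \<in> V \<and> heavy E M (parent y) y \<and> depth y < depth x" for y
    using that root_fixed less.hyps[of y] by blast
  have "p = v \<or> heavy E M (parent p) p" using heavy_parent_of_child[OF xc _ hx] by blast
  then have "\<phi> p = p" using px(2,6) by (intro fixed) auto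
  then have edge: "(p, \<phi> x) \<in> E" and heavy: "heavy E M p (\<phi> x)"
    using edge_image[OF px(1)] heavy_image[OF px(1) hx] by auto
  have "\<phi> x \<in> children p"
  proof (cases "p = v")
    case True
    then show ?thesis using edge neighbours_root by blast
  next
    case False
    show ?thesis
    proof (rule ccontr)
      assume "\<phi> x \<notin> children p"
      then have up: "\<phi> x = parent p" using edge neighbours_nonroot[OF px(2) False] by blast
      note pp = parent[OF px(2) False]
      have "parent p = v \<or> heavy E M (parent (parent p)) (parent p)"
        using heavy_parent_of_child[OF in_children_parent[OF px(2) False]]
          heavy_parent_of_child[OF xc False hx] by blast
      then have "\<phi> (parent p) = parent p" using pp px(6) by (intro fixed) auto
      with up have "x = parent p" using image_eq_iff[OF px(3) pp(3)] by simp
      with pp px show False by simp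
    qed
  qed
  then have x': "\<phi> x \<in> heavy_children p" using heavy by (simp add: heavy_children_def)
  have ne: "heavy_children p \<noteq> {}" using x by blast
  have "weight r p (\<phi> x) = weight r p x"
    using graph_automorphism_branch_sum[OF graph aut pres px(2,3), of c r] \<open>\<phi> p = p\<close> by simp
  then have "[label (\<phi> x) = label x] (mod c ^ Suc r)"
    using weight_child[OF order_refl xc ne] weight_child[OF order_refl \<open>\<phi> x \<in> children p\<close> ne]
    by (metis cong_sym cong_trans)
  moreover have "label (\<phi> x) < c ^ Suc r" "label x < c ^ Suc r"
    using heavy_labels(2)[OF px(2)] x x' by auto
  ultimately have "label (\<phi> x) = label x" by (simp add: cong_def)
  then show "\<phi> x = x" using heavy_labels(1)[OF px(2)] x x' by (auto dest: inj_onD)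
qed

lemma M_fixed: "x \<in> M \<Longrightarrow> x \<in> V \<Longrightarrow> \<phi> x = x"
  using root_fixed heavy_fixed[of x] by (cases "x = v") (auto intro: heavy.here)

end

end

theorem mainTheorem5:
  fixes V :: "'a set" and E :: "('a \<times> 'a) set" and k c r :: nat
  assumes "is_tree V E"
    and "max_valence V E k"
    and "2 \<le> c" and "c \<le> k"
    and "(1 \<le> r \<and> 3 < k \<and>
            (c = 2 \<and> k \<le> 2 ^ (r - 1) \<or> c > 2 \<and> k \<le> c ^ r * (c - 1) + 2))
         \<or> (r = 0 \<and> c = k)
         \<or> (r = 1 \<and> c = k - 1)"
  shows "\<exists>col. is_coloring V c col \<and>
           (\<forall>\<phi>. graph_automorphism V E \<phi> \<and> preserves_coloring V col \<phi> \<longrightarrow>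
                (\<forall>x\<in>V. enat r \<le> leaf_dist V E x \<longrightarrow> \<phi> x = x))"
proof -
  \<comment> \<open>All parameter ranges lead to this one bound. For c > 2 it amounts to 2 \<le>
    c^r.\<close>
  have k_le: "k \<le> c ^ Suc r"
    using assms(5)
  proof (elim disjE conjE)
    assume "c = 2" "k \<le> 2 ^ (r - 1)"
    moreover have "(2::nat) ^ (r - 1) \<le> 2 ^ Suc r" by (rule power_increasing) auto
    ultimately show ?thesis by (metis order_trans)
  next
    assume h: "1 \<le> r" "c > 2" "k \<le> c ^ r * (c - 1) + 2"
    have "c ^ 1 \<le> c ^ r" using h by (intro power_increasing) auto
    then have "2 \<le> c ^ r" using h by simp
    moreover have "c ^ Suc r = c ^ r * (c - 1) + c ^ r" using h by (cases c) auto
    ultimately show ?thesis using h(3) by linarith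
  next
    assume h: "r = 1" "c = k - 1"
    have "k = Suc c" using h(2) assms(3) by simp
    also have "\<dots> \<le> 2 * c" using assms(3) by simp
    also have "\<dots> \<le> c * c" using assms(3) by (rule mult_le_mono1)
    finally show ?thesis using h(1) by simp
  qed simp
  define M where "M = {x \<in> V. leaf_free V E r x}"
  have graph: "simple_graph V E" using assms(1) by (simp add: is_tree_def)
  have M_iff: "enat r \<le> leaf_dist V E x \<longleftrightarrow> x \<in> M" if "x \<in> V" for x
    using le_leaf_dist_iff_leaf_free[OF assms(1) that] that by (simp add: M_def)
  have M_inv: "\<phi> ` M \<subseteq> M" if "graph_automorphism V E \<phi>" for \<phi>
    using that graph_automorphism_leaf_free[OF graph] graph_automorphism_in by (fastforce simp: M_def)
  show ?thesis
  proof (cases "\<exists>w x y. x \<noteq> y \<and> (w, x) \<in> E \<and> (w, y) \<in> E \<and> heavy E M w x \<and> heavy E M w y")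
    case True
    then obtain v where v: "\<exists>x y. x \<noteq> y \<and> (v, x) \<in> E \<and> (v, y) \<in> E \<and> heavy E M v x \<and> heavy E M v y"
      by blast
    interpret branching_rooted_tree V E v c r M
    proof unfold_locales
      show "v \<in> V" using v graph by (auto simp: simple_graph_def)
      show "finite (E `` {x})" "card (E `` {x}) \<le> c ^ Suc r" if "x \<in> V" for x
        using that assms(2) k_le by (auto simp: max_valence_def valence_def)
    qed (use assms v in \<open>auto simp: M_def\<close>)
    \<comment> \<open>Shift from the digits 0, ..., c - 1 to the colors 1, ..., c.\<close>
    let ?col = "\<lambda>x. Suc (color x)"
    have "is_coloring V c ?col"
      using assms(3) by (auto simp: is_coloring_def color_def Suc_le_eq)
    moreover have "\<phi> x = x"
      if "graph_automorphism V E \<phi>" "preserves_coloring V ?col \<phi>" "x \<in> M" for \<phi> x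
    proof (rule M_fixed[OF that(1) _ M_inv[OF that(1)] that(3)])
      show "preserves_coloring V color \<phi>" using that(2) by (simp add: preserves_coloring_def)
      show "x \<in> V" using that(3) by (simp add: M_def)
    qed
    ultimately show ?thesis using M_iff by blast
  next
    case False
    then obtain a b where ab: "M \<subseteq> {a, b}"
      using few_targets[OF assms(1), of M] by (fastforce simp: M_def)
    \<comment> \<open>Singling out \<open>a\<close> suffices: an element of \<open>M\<close> other
      than \<open>a\<close> can only be \<open>b\<close>, and its image is again in \<open>M\<close>
      and different from \<open>a\<close>.\<close>
    let ?col = "\<lambda>x. if x = a then 2 else 1 :: nat"
    have "is_coloring V c ?col" using assms(3) by (auto simp: is_coloring_def)
    moreover have "\<phi> x = x"
      if \<phi>: "graph_automorphism V E \<phi>" "preserves_coloring V ?col \<phi>" and x: "x \<in> M" for \<phi> x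
    proof -
      have "x \<in> V" using x by (simp add: M_def)
      with \<phi>(2) have "\<phi> x = a \<longleftrightarrow> x = a"
        by (auto simp: preserves_coloring_def split: if_splits)
      moreover have "\<phi> x \<in> M" using M_inv[OF \<phi>(1)] x by (rule subsetD[OF _ imageI])
      ultimately show ?thesis using subsetD[OF ab, of x] subsetD[OF ab, of "\<phi> x"] x by auto
    qed
    ultimately show ?thesis using M_iff by blast
  qed
qed

end
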